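(* Let $\Phi: X\times G\to X$ be a right action of a group $G$ on a non-empty set $X$, and let $X\times_\Phi G$ be the associated quandle. Let $B$ be a complete set of representatives for the orbit space $X/G$, and let $R$ be a complete set of representatives for the conjugacy classes of $G$. Then there is a bijection $$\pi_0(X\times_\Phi G)\;\cong\;\bigsqcup_{(b,r)\in B\times R} C_G(r)\backslash G/H_b,$$ where $H_b$ is the stabilizer of $b$ in $G$ and $C_G(r)$ is the centralizer of $r$ in $G$.
   Context: A quandle is a non-empty set $Q$ with a binary operation $\triangleleft$ such that: (Q1) $x\triangleleft x=x$ for all $x$; (Q2) for every $y\in Q$ the map $s_y:Q\to Q$, $s_y(x):=x\triangleleft y$, is bijective; (Q3) $(x\triangleleft y)\triangleleft z=(x\triangleleft z)\triangleleft(y\triangleleft z)$ for all $x,y,z$. $\mathrm{Inn}(Q)$ is the group of automorphisms of $Q$ generated by the $s_y$, $y\in Q$. The connected components of $Q$ are the orbits of $\mathrm{Inn}(Q)$ on $Q$, and $\pi_0(Q)$ denotes the set of connected components. Write $x^g:=\Phi(x,g)$. $X\times_\Phi G$ denotes the quandle with underlying set $X\times G$ and operation $(x,g)\triangleleft_\Phi(y,h):=(x^{g^{-1}h},h^{-1}gh)$. *)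

theory Defs
  imports "HOL-Algebra.Group_Action" "HOL-Algebra.Generated_Groups"
begin

section \<open>Quandles\<close>

record 'a quandle_struct = "'a partial_object" +
  qop :: "'a \<Rightarrow> 'a \<Rightarrow> 'a" (infixl \<open>\<triangleleft>\<index>\<close> 70)

locale quandle =
  fixes Q (structure)
  assumes nonempty: "carrier Q \<noteq> {}"
    and closed: "\<lbrakk>x \<in> carrier Q; y \<in> carrier Q\<rbrakk> \<Longrightarrow> x \<triangleleft> y \<in> carrier Q"
    and idem: "x \<in> carrier Q \<Longrightarrow> x \<triangleleft> x = x"
    and bij: "y \<in> carrier Q \<Longrightarrow> bij_betw (\<lambda>x. x \<triangleleft> y) (carrier Q) (carrier Q)"
    and distrib: "\<lbrakk>x \<in> carrier Q; y \<in> carrier Q; z \<in> carrier Q\<rbrakk>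
      \<Longrightarrow> (x \<triangleleft> y) \<triangleleft> z = (x \<triangleleft> z) \<triangleleft> (y \<triangleleft> z)"

definition symmetry :: "('a, 'm) quandle_struct_scheme \<Rightarrow> 'a \<Rightarrow> 'a \<Rightarrow> 'a" where
  "symmetry Q y = (\<lambda>x\<in>carrier Q. x \<triangleleft>\<^bsub>Q\<^esub> y)"

definition quandle_auto :: "('a, 'm) quandle_struct_scheme \<Rightarrow> ('a \<Rightarrow> 'a) set" where
  "quandle_auto Q = {f \<in> Bij (carrier Q).
     \<forall>x\<in>carrier Q. \<forall>y\<in>carrier Q. f (x \<triangleleft>\<^bsub>Q\<^esub> y) = f x \<triangleleft>\<^bsub>Q\<^esub> f y}"

definition Aut :: "('a, 'm) quandle_struct_scheme \<Rightarrow> ('a \<Rightarrow> 'a) monoid" where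
  "Aut Q = BijGroup (carrier Q) \<lparr>carrier := quandle_auto Q\<rparr>"

definition Inn :: "('a, 'm) quandle_struct_scheme \<Rightarrow> ('a \<Rightarrow> 'a) monoid" where
  "Inn Q = Aut Q \<lparr>carrier := generate (Aut Q) (symmetry Q ` carrier Q)\<rparr>"

definition connected_components :: "('a, 'm) quandle_struct_scheme \<Rightarrow> 'a set set" (\<open>\<pi>\<^sub>0\<close>) where
  "\<pi>\<^sub>0 Q = orbits (Inn Q) (carrier Q) (\<lambda>f. f)"

lemma (in quandle) subgroup_quandle_auto: "subgroup (quandle_auto Q) (BijGroup (carrier Q))"
proof (rule group.subgroupI[OF group_BijGroup])
  show "quandle_auto Q \<subseteq> carrier (BijGroup (carrier Q))"
    by (auto simp: quandle_auto_def BijGroup_def)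
  have "(\<lambda>x\<in>carrier Q. x) \<in> quandle_auto Q"
    by (auto simp: quandle_auto_def id_Bij closed)
  then show "quandle_auto Q \<noteq> {}" by blast
next
  fix f assume f: "f \<in> quandle_auto Q"
  then have "inv_into (carrier Q) f (x \<triangleleft> y) = inv_into (carrier Q) f x \<triangleleft> inv_into (carrier Q) f y"
    if "x \<in> carrier Q" "y \<in> carrier Q" for x y
    using that by (intro Bij_inv_into_lemma) (auto simp: quandle_auto_def closed)
  then show "inv\<^bsub>BijGroup (carrier Q)\<^esub> f \<in> quandle_auto Q"
    using f restrict_inv_into_Bij[of f "carrier Q"]
    by (auto simp: quandle_auto_def inv_BijGroup closed)
next
  fix f g assume "f \<in> quandle_auto Q" "g \<in> quandle_auto Q"
  then show "f \<otimes>\<^bsub>BijGroup (carrier Q)\<^esub> g \<in> quandle_auto Q"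
    by (auto simp: quandle_auto_def BijGroup_def compose_Bij compose_eq closed
        dest!: Bij_imp_funcset simp: Pi_iff)
qed

lemma (in quandle) group_Aut: "group (Aut Q)"
  unfolding Aut_def by (rule group.subgroup_imp_group[OF group_BijGroup subgroup_quandle_auto])

lemma (in quandle) symmetry_in_Aut: "y \<in> carrier Q \<Longrightarrow> symmetry Q y \<in> carrier (Aut Q)"
  using bij[of y] distrib[of _ _ y]
  by (simp add: Aut_def quandle_auto_def symmetry_def Bij_def closed)

lemma (in quandle) subgroup_Inn: "subgroup (carrier (Inn Q)) (Aut Q)"
  unfolding Inn_def using symmetry_in_Aut
  by (auto intro: group.generate_is_subgroup[OF group_Aut])


section \<open>The quandle of a right action\<close>

locale right_group_action = group G for G (structure) +
  fixes X :: "'x set" and \<Phi> :: "'x \<Rightarrow> 'a \<Rightarrow> 'x"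
  assumes act_closed: "\<lbrakk>x \<in> X; g \<in> carrier G\<rbrakk> \<Longrightarrow> \<Phi> x g \<in> X"
    and act_one: "x \<in> X \<Longrightarrow> \<Phi> x \<one> = x"
    and act_mult: "\<lbrakk>x \<in> X; g \<in> carrier G; h \<in> carrier G\<rbrakk> \<Longrightarrow> \<Phi> x (g \<otimes> h) = \<Phi> (\<Phi> x g) h"

definition action_quandle ::
    "('g, 'm) monoid_scheme \<Rightarrow> 'x set \<Rightarrow> ('x \<Rightarrow> 'g \<Rightarrow> 'x) \<Rightarrow> ('x \<times> 'g) quandle_struct" where
  "action_quandle G X \<Phi> =
     \<lparr>carrier = X \<times> carrier G,
      qop = \<lambda>(x, g) (y, h). (\<Phi> x (inv\<^bsub>G\<^esub> g \<otimes>\<^bsub>G\<^esub> h), inv\<^bsub>G\<^esub> h \<otimes>\<^bsub>G\<^esub> g \<otimes>\<^bsub>G\<^esub> h)\<rparr>"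

lemma (in right_group_action) quandle_action_quandle:
  assumes "X \<noteq> {}"
  shows "quandle (action_quandle G X \<Phi>)" (is "quandle ?Q")
proof -
  have act: "\<Phi> (\<Phi> x a) b = \<Phi> x (a \<otimes> b)" if "x \<in> X" "a \<in> carrier G" "b \<in> carrier G" for x a b
    using act_mult that by simp
  have cancel: "inv a \<otimes> (a \<otimes> b) = b" "a \<otimes> (inv a \<otimes> b) = b"
    if "a \<in> carrier G" "b \<in> carrier G" for a b
    using that by (simp_all flip: m_assoc)
  show ?thesis
  proof
    show "carrier ?Q \<noteq> {}"
      using assms by (auto simp: action_quandle_def)
  next
    fix p q assume "p \<in> carrier ?Q" "q \<in> carrier ?Q"
    then show "p \<triangleleft>\<^bsub>?Q\<^esub> q \<in> carrier ?Q"
      by (auto simp: action_quandle_def act_closed)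
  next
    fix p assume "p \<in> carrier ?Q"
    then show "p \<triangleleft>\<^bsub>?Q\<^esub> p = p"
      by (auto simp: action_quandle_def act_one)
  next
    fix q assume "q \<in> carrier ?Q"
    then obtain y h where "q = (y, h)" "h \<in> carrier G"
      by (auto simp: action_quandle_def)
    then show "bij_betw (\<lambda>p. p \<triangleleft>\<^bsub>?Q\<^esub> q) (carrier ?Q) (carrier ?Q)"
      by (intro bij_betw_byWitness[where f' = "\<lambda>(x, g). (\<Phi> x (g \<otimes> inv h), h \<otimes> g \<otimes> inv h)"])
         (auto simp: action_quandle_def act_closed act_one act m_assoc inv_mult_group cancel)
  next
    fix p q r assume "p \<in> carrier ?Q" "q \<in> carrier ?Q" "r \<in> carrier ?Q"
    then show "p \<triangleleft>\<^bsub>?Q\<^esub> q \<triangleleft>\<^bsub>?Q\<^esub> r = p \<triangleleft>\<^bsub>?Q\<^esub> r \<triangleleft>\<^bsub>?Q\<^esub> (q \<triangleleft>\<^bsub>?Q\<^esub> r)"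
      by (auto simp: action_quandle_def act m_assoc inv_mult_group cancel)
  qed
qed


section \<open>Orbits, conjugacy classes, double cosets\<close>

text \<open>The library's \<^const>\<open>orbits\<close> and \<^const>\<open>stabilizer\<close> only refer to the
  sets \<open>{\<phi> g x | g \<in> G}\<close> and \<open>{g \<in> G. \<phi> g x = x}\<close>, so they make sense verbatim for a right
  action once its arguments are flipped.\<close>

definition right_orbits ::
    "('g, 'm) monoid_scheme \<Rightarrow> 'x set \<Rightarrow> ('x \<Rightarrow> 'g \<Rightarrow> 'x) \<Rightarrow> 'x set set" where
  "right_orbits G X \<Phi> = orbits G X (\<lambda>g x. \<Phi> x g)"

definition right_stabilizer ::
    "('g, 'm) monoid_scheme \<Rightarrow> ('x \<Rightarrow> 'g \<Rightarrow> 'x) \<Rightarrow> 'x \<Rightarrow> 'g set" where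
  "right_stabilizer G \<Phi> x = stabilizer G (\<lambda>g x. \<Phi> x g) x"

definition conjugacy_classes :: "('g, 'm) monoid_scheme \<Rightarrow> 'g set set" where
  "conjugacy_classes G =
     orbits G (carrier G) (\<lambda>g. \<lambda>h\<in>carrier G. g \<otimes>\<^bsub>G\<^esub> h \<otimes>\<^bsub>G\<^esub> inv\<^bsub>G\<^esub> g)"

definition centralizer :: "('g, 'm) monoid_scheme \<Rightarrow> 'g \<Rightarrow> 'g set" where
  "centralizer G r = {g \<in> carrier G. g \<otimes>\<^bsub>G\<^esub> r = r \<otimes>\<^bsub>G\<^esub> g}"

definition double_cosets :: "('g, 'm) monoid_scheme \<Rightarrow> 'g set \<Rightarrow> 'g set \<Rightarrow> 'g set set" where
  "double_cosets G H K = {(H #>\<^bsub>G\<^esub> g) <#>\<^bsub>G\<^esub> K | g. g \<in> carrier G}"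

definition complete_representatives :: "'a set \<Rightarrow> 'a set set \<Rightarrow> bool" where
  "complete_representatives B P \<longleftrightarrow> B \<subseteq> \<Union>P \<and> (\<forall>C\<in>P. \<exists>!b. b \<in> B \<inter> C)"

end

theory Submission
  imports Defs
begin

text \<open>
  Put \<open>(x, g)\<^sup>u = (x\<^sup>u, u\<inverse> g u)\<close>; this is the diagonal right action of \<open>G\<close> on \<open>X \<times> G\<close>, with
  \<open>G\<close> acting on itself by conjugation. Since \<open>g\<close> commutes with its own powers,
  \<open>(g\<inverse> h)\<inverse> g (g\<inverse> h) = h\<inverse> g h\<close>, so the quandle operation reads
  \<open>(x, g) \<triangleleft> (y, h) = (x, g)\<^bsup>g\<inverse> h\<^esup>\<close>. As \<open>h\<close> runs through \<open>G\<close>, so does \<open>g\<inverse> h\<close>. Hence a single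
  inner symmetry already moves a point to any point of its diagonal orbit and none leaves that
  orbit: the connected components are the diagonal orbits
  (\<open>connected_components_action_quandle\<close>).

  It remains to classify the diagonal orbits, which is the usual description of the orbits on a
  product of two \<open>G\<close>-sets. Moving the first coordinate to its representative \<open>b \<in> B\<close>, every orbit
  contains a point \<open>(b, k\<inverse> r k)\<close> with \<open>r \<in> R\<close> and \<open>k \<in> G\<close>. The pair \<open>(b, r)\<close> is determined by
  the orbit. For fixed \<open>(b, r)\<close>, the points given by \<open>k\<close> and \<open>k'\<close> are related by \<open>u\<close> exactly when
  \<open>u \<in> H\<^sub>b\<close> and \<open>k u k'\<inverse> \<in> C\<^sub>G(r)\<close>, that is, when \<open>k\<close> and \<open>k'\<close> lie in the same double coset
  (\<open>diagonal_orbit_eq_iff\<close>). So the triples \<open>(b, r, k)\<close> map onto both sides of the claim, and the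
  two maps have the same fibres.
\<close>

section \<open>Components of a quandle from an equivalence relation\<close>

text \<open>An equivalence relation that contains every step \<open>x \<mapsto> x \<triangleleft> y\<close> is respected by the inverses
  and composites of such steps, so it contains the orbit relation of the inner automorphism group.\<close>

lemma (in quandle) Inn_respects:
  assumes E: "equiv (carrier Q) E"
    and step: "\<And>x y. \<lbrakk>x \<in> carrier Q; y \<in> carrier Q\<rbrakk> \<Longrightarrow> (x, x \<triangleleft> y) \<in> E"
    and f: "f \<in> carrier (Inn Q)" and x: "x \<in> carrier Q"
  shows "(x, f x) \<in> E"
proof -
  interpret A: group "Aut Q" by (rule group_Aut)
  have sub: "generate (Aut Q) (symmetry Q ` carrier Q) \<subseteq> carrier (Aut Q)"
    using symmetry_in_Aut by (intro A.generate_incl) blast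
  have maps: "f x \<in> carrier Q" if "f \<in> carrier (Aut Q)" "x \<in> carrier Q" for f x
    using that by (auto simp: Aut_def quandle_auto_def dest!: Bij_imp_funcset)
  have mult: "(f \<otimes>\<^bsub>Aut Q\<^esub> g) x = f (g x)"
    if "f \<in> carrier (Aut Q)" "g \<in> carrier (Aut Q)" "x \<in> carrier Q" for f g x
    using that by (auto simp: Aut_def quandle_auto_def BijGroup_def compose_eq)
  have one_apply: "\<one>\<^bsub>Aut Q\<^esub> x = x" if "x \<in> carrier Q" for x
    using that by (simp add: Aut_def BijGroup_def)
  have "f \<in> generate (Aut Q) (symmetry Q ` carrier Q)"
    using f by (simp add: Inn_def)
  then show ?thesis
    using x
  proof (induction arbitrary: x)
    case one
    then show ?case using E by (simp add: one_apply equiv_def refl_on_def)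
  next
    case (incl f)
    then show ?case using step by (auto simp: symmetry_def)
  next
    case (inv f)
    then have f: "f \<in> carrier (Aut Q)" using symmetry_in_Aut by blast
    define z where "z = (inv\<^bsub>Aut Q\<^esub> f) x"
    have z: "z \<in> carrier Q" unfolding z_def using f inv.prems by (simp add: maps)
    have "f z = x"
      unfolding z_def using f inv.prems by (simp add: one_apply flip: mult)
    moreover have "(z, f z) \<in> E"
      using inv.hyps z step by (auto simp: symmetry_def)
    ultimately show ?case using E by (auto simp: z_def equiv_def dest: symD)
  next
    case (eng f g)
    have fg: "f \<in> carrier (Aut Q)" "g \<in> carrier (Aut Q)" using eng.hyps sub by blast+
    then have "(x, g x) \<in> E" "(g x, f (g x)) \<in> E"
      using eng.prems by (simp_all add: eng.IH maps)
    then show ?case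
      using E fg eng.prems by (auto simp: mult equiv_def dest: transD)
  qed
qed

text \<open>If moreover related points are always joined by a single step, then \<open>E\<close> is also contained in
  the orbit relation, and the two agree.\<close>

lemma (in quandle) connected_components_eq_quotient:
  assumes E: "equiv (carrier Q) E"
    and step: "\<And>x y. \<lbrakk>x \<in> carrier Q; y \<in> carrier Q\<rbrakk> \<Longrightarrow> (x, x \<triangleleft> y) \<in> E"
    and one_step: "\<And>x y. (x, y) \<in> E \<Longrightarrow> \<exists>z\<in>carrier Q. y = x \<triangleleft> z"
  shows "\<pi>\<^sub>0 Q = carrier Q // E"
proof -
  have "orbit (Inn Q) (\<lambda>f. f) x = E `` {x}" if x: "x \<in> carrier Q" for x
  proof
    show "orbit (Inn Q) (\<lambda>f. f) x \<subseteq> E `` {x}"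
      using Inn_respects[OF E step _ x] by (auto simp: orbit_def)
    show "E `` {x} \<subseteq> orbit (Inn Q) (\<lambda>f. f) x"
    proof
      fix y assume "y \<in> E `` {x}"
      then obtain z where z: "z \<in> carrier Q" "y = x \<triangleleft> z" using one_step by blast
      then have "symmetry Q z \<in> carrier (Inn Q)"
        by (auto simp: Inn_def intro: generate.incl)
      moreover have "y = symmetry Q z x" using x z by (simp add: symmetry_def)
      ultimately show "y \<in> orbit (Inn Q) (\<lambda>f. f) x" by (auto simp: orbit_def)
    qed
  qed
  then show ?thesis
    unfolding connected_components_def orbits_def quotient_def by auto
qed

section \<open>Orbits and representatives of a right action\<close>

context right_group_action
begin

definition orbit_relation :: "('x \<times> 'x) set" where
  "orbit_relation = {(x, \<Phi> x g) | x g. x \<in> X \<and> g \<in> carrier G}"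

lemma orbit_relation_iff:
  "(x, y) \<in> orbit_relation \<longleftrightarrow> x \<in> X \<and> (\<exists>g\<in>carrier G. y = \<Phi> x g)"
  by (auto simp: orbit_relation_def)

lemma equiv_orbit_relation: "equiv X orbit_relation"
proof (rule equivI)
  show "orbit_relation \<subseteq> X \<times> X"
    by (auto simp: orbit_relation_def act_closed)
  show "refl_on X orbit_relation"
    by (force simp: refl_on_def orbit_relation_def act_closed act_one)
  show "sym orbit_relation"
  proof (rule symI)
    fix x y assume "(x, y) \<in> orbit_relation"
    then obtain g where g: "x \<in> X" "g \<in> carrier G" "y = \<Phi> x g" by (auto simp: orbit_relation_def)
    then have "x = \<Phi> y (inv g)" "y \<in> X" by (simp_all add: act_one act_closed flip: act_mult)
    with g show "(y, x) \<in> orbit_relation" unfolding orbit_relation_def by blast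
  qed
  show "trans orbit_relation"
  proof (rule transI)
    fix x y z assume "(x, y) \<in> orbit_relation" "(y, z) \<in> orbit_relation"
    then obtain g h where "x \<in> X" "g \<in> carrier G" "h \<in> carrier G" "z = \<Phi> x (g \<otimes> h)"
      by (auto simp: orbit_relation_def act_mult)
    then show "(x, z) \<in> orbit_relation"
      unfolding orbit_relation_def using m_closed by blast
  qed
qed

lemma right_orbits_eq_quotient: "right_orbits G X \<Phi> = X // orbit_relation"
  unfolding right_orbits_def orbits_def orbit_def quotient_def orbit_relation_def by blast

lemma complete_representatives_cover:
  assumes "complete_representatives B (right_orbits G X \<Phi>)" "x \<in> X"
  obtains b g where "b \<in> B" "b \<in> X" "g \<in> carrier G" "x = \<Phi> b g"
proof -
  have "orbit_relation `` {x} \<in> right_orbits G X \<Phi>"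
    unfolding right_orbits_eq_quotient using assms(2) by (rule quotientI)
  then have "\<exists>!b. b \<in> B \<inter> orbit_relation `` {x}"
    using assms(1) unfolding complete_representatives_def by (elim conjE) (rule bspec)
  then obtain b where "b \<in> B" "(x, b) \<in> orbit_relation"
    by blast
  moreover from this have "(b, x) \<in> orbit_relation"
    using equiv_orbit_relation by (auto simp: equiv_def dest: symD)
  ultimately show ?thesis using that by (auto simp: orbit_relation_def)
qed

lemma complete_representatives_subset:
  assumes "complete_representatives B (right_orbits G X \<Phi>)"
  shows "B \<subseteq> X"
  using assms Union_quotient[OF equiv_orbit_relation]
  by (simp add: complete_representatives_def right_orbits_eq_quotient)

lemma complete_representatives_unique:
  assumes B: "complete_representatives B (right_orbits G X \<Phi>)"
    and "b \<in> B" "b' \<in> B" "g \<in> carrier G" "b' = \<Phi> b g"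
  shows "b' = b"
proof -
  have "b \<in> X" using complete_representatives_subset[OF B] assms by blast
  then have "orbit_relation `` {b} \<in> right_orbits G X \<Phi>"
    unfolding right_orbits_eq_quotient by (rule quotientI)
  then have "\<exists>!c. c \<in> B \<inter> orbit_relation `` {b}"
    using B unfolding complete_representatives_def by (elim conjE) (rule bspec)
  moreover have "b \<in> B \<inter> orbit_relation `` {b}"
    using \<open>b \<in> X\<close> assms(2) equiv_class_self[OF equiv_orbit_relation] by blast
  moreover have "b' \<in> B \<inter> orbit_relation `` {b}"
    using \<open>b \<in> X\<close> assms by (auto simp: orbit_relation_def)
  ultimately show ?thesis by blast
qed

lemma subgroup_right_stabilizer:
  assumes "x \<in> X"
  shows "subgroup (right_stabilizer G \<Phi> x) G"
proof (rule subgroupI)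
  fix a assume "a \<in> right_stabilizer G \<Phi> x"
  then have a: "a \<in> carrier G" "\<Phi> x a = x" by (auto simp: right_stabilizer_def stabilizer_def)
  then have "\<Phi> x (inv a) = \<Phi> x (a \<otimes> inv a)"
    using assms act_mult[of x a "inv a"] by simp
  then show "inv a \<in> right_stabilizer G \<Phi> x"
    using a assms by (simp add: right_stabilizer_def stabilizer_def act_one)
qed (use assms act_one in \<open>auto simp: right_stabilizer_def stabilizer_def act_mult\<close>)

end

section \<open>Conjugation and double cosets\<close>

context group
begin

abbreviation conj_by :: "'a \<Rightarrow> 'a \<Rightarrow> 'a" where
  "conj_by g u \<equiv> inv u \<otimes> g \<otimes> u"

lemma right_group_action_conj: "right_group_action G (carrier G) conj_by"
  by unfold_locales (auto simp: inv_mult_group m_assoc)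

text \<open>The conjugates \<open>u g u\<inverse>\<close> and \<open>u\<inverse> g u\<close> sweep out the same class, by \<open>u \<mapsto> u\<inverse>\<close>.\<close>

lemma conjugacy_classes_eq_right_orbits:
  "conjugacy_classes G = right_orbits G (carrier G) conj_by"
proof -
  have "{(\<lambda>h\<in>carrier G. u \<otimes> h \<otimes> inv u) g |u. u \<in> carrier G} = {conj_by g u |u. u \<in> carrier G}"
    if "g \<in> carrier G" for g
    using that by simp (metis inv_closed inv_inv)
  then show ?thesis
    unfolding conjugacy_classes_def right_orbits_def orbits_def orbit_def by blast
qed

text \<open>This makes \<open>C\<^sub>G(r)\<close> and \<open>H\<^sub>b\<close> stabilizers of the two factors of the diagonal action, so that
  the general facts on stabilizers apply to both.\<close>

lemma right_stabilizer_conj: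
  assumes "r \<in> carrier G"
  shows "right_stabilizer G conj_by r = centralizer G r"
proof -
  have "conj_by r u = r \<longleftrightarrow> u \<otimes> r = r \<otimes> u" if "u \<in> carrier G" for u
    using that assms by (metis inv_solve_left m_assoc m_closed inv_closed)
  then show ?thesis
    by (auto simp: right_stabilizer_def stabilizer_def centralizer_def)
qed

lemma double_coset_eq_iff:
  assumes H: "subgroup H G" and K: "subgroup K G" and g: "g \<in> carrier G" "g' \<in> carrier G"
  shows "(H #> g) <#> K = (H #> g') <#> K \<longleftrightarrow> (\<exists>h\<in>H. \<exists>k\<in>K. g' = h \<otimes> g \<otimes> k)"
proof
  note [simp] = subgroup.mem_carrier[OF H] subgroup.mem_carrier[OF K]
  have elems: "(H #> a) <#> K = {h \<otimes> a \<otimes> k |h k. h \<in> H \<and> k \<in> K}" for a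
    by (auto simp: r_coset_def set_mult_def)
  {
    assume "(H #> g) <#> K = (H #> g') <#> K"
    moreover have "g' = \<one> \<otimes> g' \<otimes> \<one>" using g by simp
    then have "g' \<in> (H #> g') <#> K"
      unfolding elems using subgroup.one_closed[OF H] subgroup.one_closed[OF K] by blast
    ultimately show "\<exists>h\<in>H. \<exists>k\<in>K. g' = h \<otimes> g \<otimes> k" unfolding elems by blast
  next
    assume "\<exists>h\<in>H. \<exists>k\<in>K. g' = h \<otimes> g \<otimes> k"
    then obtain h k where hk: "h \<in> H" "k \<in> K" "g' = h \<otimes> g \<otimes> k" by blast
    have sub: "(H #> h \<otimes> a \<otimes> k) <#> K \<subseteq> (H #> a) <#> K"
      if "h \<in> H" "k \<in> K" "a \<in> carrier G" for h k a
    proof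
      fix y assume "y \<in> (H #> h \<otimes> a \<otimes> k) <#> K"
      then obtain h' k' where "h' \<in> H" "k' \<in> K" "y = h' \<otimes> (h \<otimes> a \<otimes> k) \<otimes> k'"
        unfolding elems by blast
      then have "y = (h' \<otimes> h) \<otimes> a \<otimes> (k \<otimes> k')" "h' \<otimes> h \<in> H" "k \<otimes> k' \<in> K"
        using that H K by (simp_all add: m_assoc subgroup.m_closed)
      then show "y \<in> (H #> a) <#> K" unfolding elems by blast
    qed
    have "inv h \<otimes> g' \<otimes> inv k = inv h \<otimes> (h \<otimes> (g \<otimes> (k \<otimes> inv k)))"
      using hk g(1) by (simp only: m_assoc m_closed inv_closed
          subgroup.mem_carrier[OF H] subgroup.mem_carrier[OF K])
    also have "\<dots> = g"
      using hk(1,2) g(1) by (simp flip: m_assoc)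
    finally have "inv h \<otimes> g' \<otimes> inv k = g" .
    moreover have "inv h \<in> H" "inv k \<in> K"
      using hk H K by (simp_all add: subgroup.m_inv_closed)
    ultimately have "(H #> g) <#> K \<subseteq> (H #> g') <#> K"
      using sub[of "inv h" "inv k" g'] g(2) by metis
    moreover have "(H #> g') <#> K \<subseteq> (H #> g) <#> K"
      using sub[OF hk(1,2) g(1)] unfolding hk(3) .
    ultimately show "(H #> g) <#> K = (H #> g') <#> K" by (rule equalityI)
  }
qed

end

section \<open>The diagonal action and the components of its quandle\<close>

context right_group_action
begin

abbreviation diagonal :: "'x \<times> 'a \<Rightarrow> 'a \<Rightarrow> 'x \<times> 'a" where
  "diagonal p u \<equiv> (\<Phi> (fst p) u, conj_by (snd p) u)"

lemma right_group_action_diagonal: "right_group_action G (X \<times> carrier G) diagonal"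
  by unfold_locales
    (auto simp: act_closed act_one act_mult inv_mult_group m_assoc)

interpretation diagonal: right_group_action G "X \<times> carrier G" diagonal
  by (rule right_group_action_diagonal)

lemma action_quandle_op:
  assumes "g \<in> carrier G" "h \<in> carrier G"
  shows "(x, g) \<triangleleft>\<^bsub>action_quandle G X \<Phi>\<^esub> (y, h) = diagonal (x, g) (inv g \<otimes> h)"
proof -
  have "inv h \<otimes> g \<otimes> h = inv h \<otimes> g \<otimes> (g \<otimes> (inv g \<otimes> h))"
    using assms by (simp flip: m_assoc)
  then show ?thesis
    using assms by (simp add: action_quandle_def inv_mult_group m_assoc)
qed

text \<open>A point \<open>(x, g)\<close> is sent by \<open>(y, h)\<close> to its diagonal translate by \<open>g\<inverse> h\<close>, so the step
  that translates it by a prescribed \<open>u\<close> is given by \<open>h = g u\<close>, with any \<open>y\<close>.\<close>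

theorem connected_components_action_quandle:
  "\<pi>\<^sub>0 (action_quandle G X \<Phi>) = right_orbits G (X \<times> carrier G) diagonal"
proof (cases "X = {}")
  case True
  then show ?thesis
    by (simp add: connected_components_def right_orbits_def orbits_def action_quandle_def)
next
  case False
  interpret Q: quandle "action_quandle G X \<Phi>" by (rule quandle_action_quandle[OF False])
  have carrier: "carrier (action_quandle G X \<Phi>) = X \<times> carrier G"
    by (simp add: action_quandle_def)
  have "\<pi>\<^sub>0 (action_quandle G X \<Phi>) = carrier (action_quandle G X \<Phi>) // diagonal.orbit_relation"
  proof (rule Q.connected_components_eq_quotient)
    show "equiv (carrier (action_quandle G X \<Phi>)) diagonal.orbit_relation"
      unfolding carrier by (rule diagonal.equiv_orbit_relation)
  next
    fix p q assume "p \<in> carrier (action_quandle G X \<Phi>)" "q \<in> carrier (action_quandle G X \<Phi>)"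
    then obtain x g y h where pq: "p = (x, g)" "q = (y, h)" "x \<in> X" "g \<in> carrier G" "h \<in> carrier G"
      by (auto simp: carrier)
    have "p \<triangleleft>\<^bsub>action_quandle G X \<Phi>\<^esub> q = diagonal p (inv g \<otimes> h)"
      using pq by (simp only: action_quandle_op)
    moreover have "p \<in> X \<times> carrier G" "inv g \<otimes> h \<in> carrier G" using pq by auto
    ultimately show "(p, p \<triangleleft>\<^bsub>action_quandle G X \<Phi>\<^esub> q) \<in> diagonal.orbit_relation"
      unfolding diagonal.orbit_relation_def by blast
  next
    fix p q assume "(p, q) \<in> diagonal.orbit_relation"
    then obtain x g u where pq: "p = (x, g)" "x \<in> X" "g \<in> carrier G" "u \<in> carrier G"
        "q = diagonal (x, g) u"
      by (auto simp: diagonal.orbit_relation_def)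
    then have "q = p \<triangleleft>\<^bsub>action_quandle G X \<Phi>\<^esub> (x, g \<otimes> u)"
      by (simp add: action_quandle_op del: fst_conv snd_conv flip: m_assoc)
    moreover have "(x, g \<otimes> u) \<in> carrier (action_quandle G X \<Phi>)"
      using pq by (simp add: carrier)
    ultimately show "\<exists>z\<in>carrier (action_quandle G X \<Phi>). q = p \<triangleleft>\<^bsub>action_quandle G X \<Phi>\<^esub> z"
      by blast
  qed
  then show ?thesis by (simp only: carrier diagonal.right_orbits_eq_quotient)
qed

end

section \<open>Diagonal orbits and double cosets\<close>

lemma ex_bij_betw_images_if_same_fibres:
  assumes "\<And>a a'. \<lbrakk>a \<in> A; a' \<in> A\<rbrakk> \<Longrightarrow> f a = f a' \<longleftrightarrow> g a = g a'"
  shows "\<exists>h. bij_betw h (f ` A) (g ` A)"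
proof
  have eq: "g (inv_into A f (f a)) = g a" if "a \<in> A" for a
    using that assms[of "inv_into A f (f a)" a] by (simp add: inv_into_into f_inv_into_f)
  show "bij_betw (\<lambda>s. g (inv_into A f s)) (f ` A) (g ` A)"
    unfolding bij_betw_def inj_on_def by (auto simp: eq assms image_image)
qed

context right_group_action
begin

interpretation diagonal: right_group_action G "X \<times> carrier G" diagonal
  by (rule right_group_action_diagonal)

text \<open>If \<open>u\<close> moves \<open>(b, k\<inverse> r k)\<close> to \<open>(b, k'\<inverse> r k')\<close>, then \<open>u\<close> fixes \<open>b\<close> and \<open>c = k' u\<inverse> k\<inverse>\<close>
  commutes with \<open>r\<close>, and \<open>k' = c k u\<close>. Conversely, \<open>k' = c k u\<close> of this form lets \<open>u\<close> do the move.\<close>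

lemma diagonal_orbit_eq_iff:
  assumes b: "b \<in> X" and r: "r \<in> carrier G" and k: "k \<in> carrier G" and k': "k' \<in> carrier G"
  shows "(\<exists>u\<in>carrier G. (b, conj_by r k') = diagonal (b, conj_by r k) u) \<longleftrightarrow>
    (centralizer G r #> k) <#> right_stabilizer G \<Phi> b =
    (centralizer G r #> k') <#> right_stabilizer G \<Phi> b"
proof -
  interpret C: right_group_action G "carrier G" conj_by by (rule right_group_action_conj)
  have "(\<exists>u\<in>carrier G. (b, conj_by r k') = diagonal (b, conj_by r k) u) \<longleftrightarrow>
    (\<exists>c\<in>centralizer G r. \<exists>u\<in>right_stabilizer G \<Phi> b. k' = c \<otimes> k \<otimes> u)"
  proof
    assume "\<exists>u\<in>carrier G. (b, conj_by r k') = diagonal (b, conj_by r k) u"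
    then obtain u where u: "u \<in> carrier G" "\<Phi> b u = b" "conj_by r k' = conj_by (conj_by r k) u"
      by auto
    define c where "c = k' \<otimes> inv (k \<otimes> u)"
    have c: "c \<in> carrier G" using u(1) k k' by (simp add: c_def)
    have "conj_by r c = conj_by (conj_by r k') (inv (k \<otimes> u))"
      unfolding c_def using r k k' u(1) by (intro C.act_mult) auto
    also have "conj_by r k' = conj_by r (k \<otimes> u)"
      using u(3) C.act_mult[OF r k u(1)] by simp
    also have "conj_by \<dots> (inv (k \<otimes> u)) = conj_by r (k \<otimes> u \<otimes> inv (k \<otimes> u))"
      using r k u(1) by (intro C.act_mult[symmetric]) auto
    also have "\<dots> = r"
      using r k u(1) by (simp add: r_inv)
    finally have "c \<in> centralizer G r"
      using c by (simp add: right_stabilizer_def stabilizer_def flip: right_stabilizer_conj[OF r])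
    moreover have "k' = c \<otimes> k \<otimes> u"
      using u(1) k k' by (simp add: c_def m_assoc)
    ultimately show "\<exists>c\<in>centralizer G r. \<exists>u\<in>right_stabilizer G \<Phi> b. k' = c \<otimes> k \<otimes> u"
      using u by (auto simp: right_stabilizer_def stabilizer_def)
  next
    assume "\<exists>c\<in>centralizer G r. \<exists>u\<in>right_stabilizer G \<Phi> b. k' = c \<otimes> k \<otimes> u"
    then obtain c u where c: "c \<in> carrier G" "conj_by r c = r"
      and u: "u \<in> carrier G" "\<Phi> b u = b" and eq: "k' = c \<otimes> k \<otimes> u"
      by (auto simp: right_stabilizer_def stabilizer_def simp flip: right_stabilizer_conj[OF r])
    have "conj_by r k' = conj_by (conj_by (conj_by r c) k) u"
      unfolding eq using r k c(1) u(1) by (simp add: C.act_mult[symmetric])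
    then show "\<exists>u\<in>carrier G. (b, conj_by r k') = diagonal (b, conj_by r k) u"
      using u unfolding c(2) by (intro bexI[of _ u]) simp_all
  qed
  moreover have "subgroup (centralizer G r) G"
    using C.subgroup_right_stabilizer[OF r] by (simp add: right_stabilizer_conj[OF r])
  ultimately show ?thesis
    using subgroup_right_stabilizer[OF b] k k' by (simp add: double_coset_eq_iff)
qed

text \<open>The triples \<open>((b, r), k)\<close> parametrise both sides: send such a triple to the orbit of
  \<open>(b, k\<inverse> r k)\<close>, or to the double coset of \<open>k\<close> in the summand of \<open>(b, r)\<close>. Both maps are onto and
  they have the same fibres: if two triples give the same orbit, then \<open>b\<close> agrees because \<open>B\<close> meets
  each \<open>G\<close>-orbit once, \<open>r\<close> agrees because \<open>R\<close> meets each conjugacy class once, and what remains is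
  the comparison of \<open>k\<close> for fixed \<open>(b, r)\<close>.\<close>

theorem ex_bij_betw_components_double_cosets:
  assumes B: "complete_representatives B (right_orbits G X \<Phi>)"
    and "complete_representatives R (conjugacy_classes G)"
  shows "\<exists>f. bij_betw f (\<pi>\<^sub>0 (action_quandle G X \<Phi>))
    (SIGMA (b, r) : B \<times> R. double_cosets G (centralizer G r) (right_stabilizer G \<Phi> b))"
proof -
  interpret C: right_group_action G "carrier G" conj_by by (rule right_group_action_conj)
  note R = assms(2)[unfolded conjugacy_classes_eq_right_orbits]
  note BX = complete_representatives_subset[OF B] and RG = C.complete_representatives_subset[OF R]
  define T where "T = (B \<times> R) \<times> carrier G"
  define point where "point = (\<lambda>((b :: 'x, r), k). (b, conj_by r k))"
  define component where "component t = diagonal.orbit_relation `` {point t}" for t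
  define coset where
    "coset = (\<lambda>((b :: 'x, r), k). ((b, r), (centralizer G r #> k) <#> right_stabilizer G \<Phi> b))"
  have point: "point t \<in> X \<times> carrier G" if "t \<in> T" for t
    using that BX RG by (auto simp: T_def point_def)
  have "component ` T = (X \<times> carrier G) // diagonal.orbit_relation"
  proof
    show "component ` T \<subseteq> (X \<times> carrier G) // diagonal.orbit_relation"
      using point by (auto simp: component_def intro: quotientI)
    show "(X \<times> carrier G) // diagonal.orbit_relation \<subseteq> component ` T"
    proof
      fix S assume "S \<in> (X \<times> carrier G) // diagonal.orbit_relation"
      then obtain x g where S: "x \<in> X" "g \<in> carrier G" "S = diagonal.orbit_relation `` {(x, g)}"
        by (auto elim!: quotientE)
      obtain b u where b: "b \<in> B" "b \<in> X" "u \<in> carrier G" "x = \<Phi> b u"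
        using complete_representatives_cover[OF B S(1)] .
      obtain r v where r: "r \<in> R" "r \<in> carrier G" "v \<in> carrier G" "g = conj_by r v"
        using C.complete_representatives_cover[OF R S(2)] .
      \<comment> \<open>Acting by \<open>u\<inverse>\<close> takes \<open>(b\<^sup>u, v\<inverse> r v)\<close> to \<open>(b, k\<inverse> r k)\<close> with \<open>k = v u\<inverse>\<close>.\<close>
      define t where "t = ((b, r), v \<otimes> inv u)"
      have t: "t \<in> T" using b r by (simp add: t_def T_def)
      have "conj_by r (v \<otimes> inv u \<otimes> u) = conj_by (conj_by r (v \<otimes> inv u)) u"
        using b r by (intro C.act_mult) auto
      moreover have "v \<otimes> inv u \<otimes> u = v" using b r by (simp add: m_assoc)
      ultimately have "(x, g) = diagonal (point t) u"
        using b(4) r(4) by (simp add: point_def t_def)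
      then have "(point t, (x, g)) \<in> diagonal.orbit_relation"
        using b(3) point[OF t] unfolding diagonal.orbit_relation_iff by blast
      then have "S = component t"
        using equiv_class_eq[OF diagonal.equiv_orbit_relation] S(3) by (simp add: component_def)
      then show "S \<in> component ` T" using t by blast
    qed
  qed
  then have components: "component ` T = \<pi>\<^sub>0 (action_quandle G X \<Phi>)"
    by (simp only: connected_components_action_quandle diagonal.right_orbits_eq_quotient)
  have cosets: "coset ` T =
    (SIGMA (b, r) : B \<times> R. double_cosets G (centralizer G r) (right_stabilizer G \<Phi> b))"
    by (force simp: coset_def T_def double_cosets_def)
  have "component t = component t' \<longleftrightarrow> coset t = coset t'" if T: "t \<in> T" "t' \<in> T" for t t'
  proof -
    obtain b r k b' r' k' where t: "t = ((b, r), k)" "t' = ((b', r'), k')"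
      and br: "b \<in> B" "b' \<in> B" "r \<in> R" "r' \<in> R" and k: "k \<in> carrier G" "k' \<in> carrier G"
      using T by (auto simp: T_def)
    have X: "b \<in> X" "b' \<in> X" and G: "r \<in> carrier G" "r' \<in> carrier G" using br BX RG by auto
    have comp: "component t = component t' \<longleftrightarrow>
        (\<exists>u\<in>carrier G. (b', conj_by r' k') = diagonal (b, conj_by r k) u)"
    proof -
      have "component t = component t' \<longleftrightarrow> (point t, point t') \<in> diagonal.orbit_relation"
        using eq_equiv_class_iff[OF diagonal.equiv_orbit_relation point point] T
        by (simp add: component_def)
      also have "\<dots> \<longleftrightarrow> (\<exists>u\<in>carrier G. point t' = diagonal (point t) u)"
        using point[OF T(1)] unfolding diagonal.orbit_relation_iff by blast
      finally show ?thesis by (simp add: point_def t)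
    qed
    have same: "b' = b \<and> r' = r" if eq: "component t = component t'"
    proof
      obtain u where u: "u \<in> carrier G" "b' = \<Phi> b u" "conj_by r' k' = conj_by (conj_by r k) u"
        using eq comp by auto
      show "b' = b" by (rule complete_representatives_unique[OF B br(1,2) u(1,2)])
      have "r' = conj_by r' (k' \<otimes> inv k')" using G k by simp
      also have "\<dots> = conj_by (conj_by r' k') (inv k')"
        using G k by (intro C.act_mult) auto
      also have "conj_by r' k' = conj_by r (k \<otimes> u)"
        using u(3) C.act_mult[OF G(1) k(1) u(1)] by simp
      also have "conj_by \<dots> (inv k') = conj_by r (k \<otimes> u \<otimes> inv k')"
        using G k u(1) by (intro C.act_mult[symmetric]) auto
      finally have "r' = conj_by r (k \<otimes> u \<otimes> inv k')" .
      with k u(1) show "r' = r"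
        by (intro C.complete_representatives_unique[OF R br(3,4)]) simp_all
    qed
    show ?thesis
    proof (cases "b' = b \<and> r' = r")
      case True
      then show ?thesis
        using comp diagonal_orbit_eq_iff[OF X(1) G(1) k] by (simp add: t coset_def)
    next
      case False
      then have "component t \<noteq> component t'" using same by blast
      moreover have "coset t \<noteq> coset t'" using False by (auto simp: t coset_def)
      ultimately show ?thesis by simp
    qed
  qed
  from ex_bij_betw_images_if_same_fibres[of T component coset, OF this]
  show ?thesis unfolding components cosets .
qed

end

theorem theorem1p3:
  fixes G :: "('g, 'm) monoid_scheme" and X :: "'x set" and \<Phi> :: "'x \<Rightarrow> 'g \<Rightarrow> 'x"
    and B :: "'x set" and R :: "'g set"
  assumes "right_group_action G X \<Phi>"
    and "X \<noteq> {}"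
    and "complete_representatives B (right_orbits G X \<Phi>)"
    and "complete_representatives R (conjugacy_classes G)"
  shows "\<exists>f. bij_betw f (\<pi>\<^sub>0 (action_quandle G X \<Phi>))
    (SIGMA (b, r) : B \<times> R. double_cosets G (centralizer G r) (right_stabilizer G \<Phi> b))"
  by (rule right_group_action.ex_bij_betw_components_double_cosets[OF assms(1,3,4)])

end
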